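(* Let $r,n$ be positive integers and $p,p',q,q'$ positive divisors of $r$ with $pq=p'q'$ dividing $rn$. If $\mathrm{GCD}(p,n)=\mathrm{GCD}(p',n)$ and $\mathrm{GCD}(q,n)=\mathrm{GCD}(q',n)$, then $G(r,p,q,n)\cong G(r,p',q',n)$.
   Context: For a positive integer $r$ let $\zeta_r=\exp(2\pi\sqrt{-1}/r)$ and $\mathbb{Z}_r=\mathbb{Z}/r\mathbb{Z}$. $G(r,n)$ is the group of $n\times n$ complex matrices with exactly one nonzero entry in each row and column, each nonzero entry an $r$th root of unity; its elements are written $(\pi,x)$ with $\pi\in S_n$, $x\in(\mathbb{Z}_r)^n$, meaning the matrix whose $i$th column has $\zeta_r^{x_i}$ in row $\pi(i)$. Put $\Delta(\pi,x)=\sum_i x_i$. For $p\mid r$, $G(r,p,n)=\{g\in G(r,n):\Delta(g)\in p\mathbb{Z}_r\}$. With $c=\zeta_rI_n$, when $p,q\mid r$ and $pq\mid rn$ the group $C_q=\langle c^{r/q}\rangle$ is central of order $q$ in $G(r,p,n)$ and $G(r,p,q,n):=G(r,p,n)/C_q$. *)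

theory Defs
  imports
    Complex_Main
    "HOL-Combinatorics.Permutations"
    "HOL-Algebra.Generated_Groups"
    "HOL-Algebra.Coset"
    "Jordan_Normal_Form.Matrix"
begin

definition zeta :: "nat \<Rightarrow> complex" where
  "zeta r = exp (2 * of_real pi * \<i> / of_nat r)"

text \<open>Rows and columns are numbered from 0 to \<open>n - 1\<close>.\<close>

definition G_rn_carrier :: "nat \<Rightarrow> nat \<Rightarrow> complex mat set" where
  "G_rn_carrier r n = {A \<in> carrier_mat n n.
     (\<forall>i<n. \<exists>!j. j < n \<and> A $$ (i, j) \<noteq> 0) \<and>
     (\<forall>j<n. \<exists>!i. i < n \<and> A $$ (i, j) \<noteq> 0) \<and>
     (\<forall>i<n. \<forall>j<n. A $$ (i, j) \<noteq> 0 \<longrightarrow> A $$ (i, j) ^ r = 1)}"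

definition G_rn :: "nat \<Rightarrow> nat \<Rightarrow> complex mat monoid" where
  "G_rn r n = \<lparr>carrier = G_rn_carrier r n, monoid.mult = (*), one = 1\<^sub>m n\<rparr>"

text \<open>The matrix written \<open>(\<pi>, x)\<close>. The elements of \<open>\<int>/r\<int>\<close> are represented by natural
  numbers, and the matrix depends only on their residues modulo \<open>r\<close>.\<close>

definition colored_perm :: "nat \<Rightarrow> nat \<Rightarrow> (nat \<Rightarrow> nat) \<Rightarrow> (nat \<Rightarrow> nat) \<Rightarrow> complex mat" where
  "colored_perm r n \<pi> x = mat n n (\<lambda>(k, i). if k = \<pi> i then zeta r ^ x i else 0)"

text \<open>The value in \<open>\<int>/r\<int>\<close> is given by its representative in \<open>{0..<r}\<close>. The lemmas
  \<open>G_rn_carrier_eq\<close> and \<open>Delta_colored_perm\<close> below show that the description is proper on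
  \<open>G_rn_carrier r n\<close>.\<close>

definition Delta :: "nat \<Rightarrow> nat \<Rightarrow> complex mat \<Rightarrow> nat" where
  "Delta r n g = (THE d. \<exists>\<pi> x. \<pi> permutes {..<n} \<and> g = colored_perm r n \<pi> x \<and>
     d = (\<Sum>i<n. x i) mod r)"

definition G_rpn :: "nat \<Rightarrow> nat \<Rightarrow> nat \<Rightarrow> complex mat monoid" where
  "G_rpn r p n = (G_rn r n)
     \<lparr>carrier := {g \<in> carrier (G_rn r n). Delta r n g \<in> {(p * k) mod r | k. True}}\<rparr>"

definition C_q :: "nat \<Rightarrow> nat \<Rightarrow> nat \<Rightarrow> complex mat set" where
  "C_q r q n = generate (G_rn r n) {(zeta r \<cdot>\<^sub>m 1\<^sub>m n) [^]\<^bsub>G_rn r n\<^esub> (r div q)}"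

text \<open>A well-formed quotient only if \<open>p\<close> and \<open>q\<close> divide \<open>r\<close> and \<open>p * q\<close> divides \<open>r * n\<close>:
  see \<open>C_q_normal\<close> below.\<close>

definition G_rpqn :: "nat \<Rightarrow> nat \<Rightarrow> nat \<Rightarrow> nat \<Rightarrow> complex mat set monoid" where
  "G_rpqn r p q n = G_rpn r p n Mod C_q r q n"

lemma zeta_power_order: "r > 0 \<Longrightarrow> zeta r ^ r = 1"
  by (simp add: zeta_def flip: exp_of_nat_mult)

lemma zeta_nonzero [simp]: "zeta r \<noteq> 0"
  by (simp add: zeta_def)

lemma zeta_power_cis: "zeta r ^ a = cis (2 * pi * real a / real r)"
  by (simp add: zeta_def cis_conv_exp field_simps flip: exp_of_nat_mult)

lemma zeta_power_mod: "r > 0 \<Longrightarrow> zeta r ^ (a mod r) = zeta r ^ a"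
  by (metis mod_mult_div_eq mult.right_neutral power_add power_mult power_one zeta_power_order)

lemma zeta_power_eq_iff:
  assumes "r > 0"
  shows "zeta r ^ a = zeta r ^ b \<longleftrightarrow> a mod r = b mod r"
proof
  assume "zeta r ^ a = zeta r ^ b"
  then have "zeta r ^ (a mod r) = zeta r ^ (b mod r)"
    using assms by (simp add: zeta_power_mod)
  with bij_betw_roots_unity[OF assms] show "a mod r = b mod r"
    using assms by (auto simp: zeta_power_cis bij_betw_def dest: inj_onD)
next
  assume "a mod r = b mod r"
  then show "zeta r ^ a = zeta r ^ b"
    by (metis assms zeta_power_mod)
qed

lemma root_of_unity_zeta:
  assumes "r > 0" "z ^ r = 1"
  shows "\<exists>k. z = zeta r ^ k"
proof -
  from bij_betw_roots_unity[OF assms(1)] assms(2)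
  have "z \<in> (\<lambda>k. cis (2 * pi * real k / real r)) ` {..<r}"
    by (simp add: bij_betw_def)
  then show ?thesis by (auto simp: zeta_power_cis)
qed

lemma colored_perm_index:
  "k < n \<Longrightarrow> i < n \<Longrightarrow>
    colored_perm r n \<pi> x $$ (k, i) = (if k = \<pi> i then zeta r ^ x i else 0)"
  by (simp add: colored_perm_def)

lemma colored_perm_eq_iff:
  assumes "r > 0" "\<pi> permutes {..<n}" "\<sigma> permutes {..<n}"
  shows "colored_perm r n \<pi> x = colored_perm r n \<sigma> y \<longleftrightarrow>
    \<pi> = \<sigma> \<and> (\<forall>i<n. x i mod r = y i mod r)"
proof
  assume eq: "colored_perm r n \<pi> x = colored_perm r n \<sigma> y"
  have *: "\<pi> i = \<sigma> i \<and> x i mod r = y i mod r" if "i < n" for i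
  proof -
    have "\<pi> i < n" using assms(2) that by (metis lessThan_iff permutes_in_image)
    with eq that have "zeta r ^ x i = (if \<pi> i = \<sigma> i then zeta r ^ y i else 0)"
      by (metis colored_perm_index)
    then show ?thesis using assms(1) by (auto simp: zeta_power_eq_iff split: if_splits)
  qed
  moreover have "\<pi> i = \<sigma> i" if "\<not> i < n" for i
    using assms that by (simp add: permutes_def)
  ultimately show "\<pi> = \<sigma> \<and> (\<forall>i<n. x i mod r = y i mod r)" by blast
next
  assume "\<pi> = \<sigma> \<and> (\<forall>i<n. x i mod r = y i mod r)"
  then show "colored_perm r n \<pi> x = colored_perm r n \<sigma> y"
    using assms(1) by (auto intro!: eq_matI simp: colored_perm_def zeta_power_eq_iff)
qed

lemma Delta_colored_perm:
  assumes "r > 0" "\<pi> permutes {..<n}"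
  shows "Delta r n (colored_perm r n \<pi> x) = (\<Sum>i<n. x i) mod r"
  unfolding Delta_def
proof (rule the_equality)
  show "\<exists>\<sigma> y. \<sigma> permutes {..<n} \<and> colored_perm r n \<pi> x = colored_perm r n \<sigma> y \<and>
      (\<Sum>i<n. x i) mod r = (\<Sum>i<n. y i) mod r"
    using assms(2) by blast
next
  fix d
  assume "\<exists>\<sigma> y. \<sigma> permutes {..<n} \<and> colored_perm r n \<pi> x = colored_perm r n \<sigma> y \<and>
      d = (\<Sum>i<n. y i) mod r"
  then obtain \<sigma> y where "\<forall>i<n. x i mod r = y i mod r" "d = (\<Sum>i<n. y i) mod r"
    using colored_perm_eq_iff[OF assms(1) assms(2)] by blast
  then show "d = (\<Sum>i<n. x i) mod r"
    by (metis (no_types, lifting) lessThan_iff mod_sum_eq sum.cong)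
qed

lemma G_rn_carrier_eq:
  assumes "r > 0"
  shows "G_rn_carrier r n = {colored_perm r n \<pi> x | \<pi> x. \<pi> permutes {..<n}}"
proof (intro equalityI subsetI)
  fix A assume A: "A \<in> G_rn_carrier r n"
  then have dim: "A \<in> carrier_mat n n" by (simp add: G_rn_carrier_def)
  from A have row: "\<exists>!j. j < n \<and> A $$ (i, j) \<noteq> 0" if "i < n" for i
    using that by (auto simp: G_rn_carrier_def)
  from A have col: "\<exists>!i. i < n \<and> A $$ (i, j) \<noteq> 0" if "j < n" for j
    using that by (auto simp: G_rn_carrier_def)
  from A have root: "A $$ (i, j) ^ r = 1" if "i < n" "j < n" "A $$ (i, j) \<noteq> 0" for i j
    using that by (auto simp: G_rn_carrier_def)
  define \<pi> where "\<pi> j = (if j < n then THE i. i < n \<and> A $$ (i, j) \<noteq> 0 else j)" for j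
  have \<pi>: "\<pi> j < n \<and> A $$ (\<pi> j, j) \<noteq> 0" if "j < n" for j
    using theI'[OF col[OF that]] that by (simp add: \<pi>_def)
  have "inj_on \<pi> {..<n}"
    by (rule inj_onI) (metis \<pi> lessThan_iff row)
  moreover have "\<pi> ` {..<n} \<subseteq> {..<n}" using \<pi> by auto
  ultimately have "bij_betw \<pi> {..<n} {..<n}"
    by (simp add: bij_betw_def endo_inj_surj)
  then have perm: "\<pi> permutes {..<n}"
    by (rule bij_imp_permutes) (simp add: \<pi>_def)
  have "\<forall>j. \<exists>k. j < n \<longrightarrow> A $$ (\<pi> j, j) = zeta r ^ k"
    using root_of_unity_zeta[OF assms] root \<pi> by blast
  then obtain x where x: "A $$ (\<pi> j, j) = zeta r ^ x j" if "j < n" for j by metis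
  have "A = colored_perm r n \<pi> x"
  proof (rule eq_matI)
    fix i j assume "i < dim_row (colored_perm r n \<pi> x)" "j < dim_col (colored_perm r n \<pi> x)"
    then have ij: "i < n" "j < n" by (simp_all add: colored_perm_def)
    have "A $$ (i, j) = 0" if "i \<noteq> \<pi> j" using col[OF ij(2)] \<pi>[OF ij(2)] that ij by blast
    then show "A $$ (i, j) = colored_perm r n \<pi> x $$ (i, j)"
      using ij x by (auto simp: colored_perm_index)
  qed (use dim in \<open>auto simp: colored_perm_def\<close>)
  with perm show "A \<in> {colored_perm r n \<pi> x | \<pi> x. \<pi> permutes {..<n}}" by blast
next
  fix A assume "A \<in> {colored_perm r n \<pi> x | \<pi> x. \<pi> permutes {..<n}}"
  then obtain \<pi> x where A: "A = colored_perm r n \<pi> x" and perm: "\<pi> permutes {..<n}" by blast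
  have lt: "\<pi> j < n" if "j < n" for j using perm that by (metis lessThan_iff permutes_in_image)
  have surj: "\<exists>!j. j < n \<and> i = \<pi> j" if "i < n" for i
    using perm that by (metis lessThan_iff permutes_def permutes_in_image)
  have nz: "A $$ (i, j) \<noteq> 0 \<longleftrightarrow> i = \<pi> j" if "i < n" "j < n" for i j
    using that by (simp add: A colored_perm_index)
  have "\<exists>!j. j < n \<and> A $$ (i, j) \<noteq> 0" if "i < n" for i
    using surj[OF that] nz[OF that] by metis
  moreover have "\<exists>!i. i < n \<and> A $$ (i, j) \<noteq> 0" if "j < n" for j
    using lt[OF that] nz that by metis
  moreover have "(zeta r ^ k) ^ r = 1" for k
    using assms by (metis mult.commute power_mult power_one zeta_power_order)
  ultimately show "A \<in> G_rn_carrier r n"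
    by (auto simp: G_rn_carrier_def A colored_perm_index) (simp add: colored_perm_def)
qed

lemma colored_perm_mult:
  assumes "\<sigma> permutes {..<n}"
  shows "colored_perm r n \<pi> x * colored_perm r n \<sigma> y =
    colored_perm r n (\<pi> \<circ> \<sigma>) (\<lambda>i. x (\<sigma> i) + y i)"
proof (rule eq_matI)
  fix k i
  assume "k < dim_row (colored_perm r n (\<pi> \<circ> \<sigma>) (\<lambda>i. x (\<sigma> i) + y i))"
    "i < dim_col (colored_perm r n (\<pi> \<circ> \<sigma>) (\<lambda>i. x (\<sigma> i) + y i))"
  then have ki: "k < n" "i < n" by (simp_all add: colored_perm_def)
  then have \<sigma>: "\<sigma> i < n" using assms by (metis lessThan_iff permutes_in_image)
  have "(colored_perm r n \<pi> x * colored_perm r n \<sigma> y) $$ (k, i) =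
      (\<Sum>j<n. colored_perm r n \<pi> x $$ (k, j) * colored_perm r n \<sigma> y $$ (j, i))"
    using ki by (simp add: colored_perm_def scalar_prod_def atLeast0LessThan)
  also have "\<dots> = (\<Sum>j<n. if j = \<sigma> i then colored_perm r n \<pi> x $$ (k, j) * zeta r ^ y i else 0)"
    using ki by (intro sum.cong) (auto simp: colored_perm_index)
  also have "\<dots> = colored_perm r n \<pi> x $$ (k, \<sigma> i) * zeta r ^ y i"
    using \<sigma> by simp
  finally show "(colored_perm r n \<pi> x * colored_perm r n \<sigma> y) $$ (k, i) =
      colored_perm r n (\<pi> \<circ> \<sigma>) (\<lambda>i. x (\<sigma> i) + y i) $$ (k, i)"
    using ki \<sigma> by (simp add: colored_perm_index power_add)
qed (simp_all add: colored_perm_def)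

lemma one_colored_perm: "1\<^sub>m n = colored_perm r n id (\<lambda>i. 0)"
  by (auto intro!: eq_matI simp: colored_perm_def)

lemma colored_perm_inverse:
  assumes "r > 0" "\<pi> permutes {..<n}"
  shows "colored_perm r n (inv_into UNIV \<pi>) (\<lambda>i. (r - 1) * x (inv_into UNIV \<pi> i)) * colored_perm r n \<pi> x = 1\<^sub>m n"
proof -
  have "(r - 1) * a + a = r * a" for a
    using assms(1) by (metis Suc_diff_1 add.commute mult_Suc)
  then show ?thesis using assms
    by (simp add: colored_perm_mult permutes_inverses permutes_inv_o permutes_id
        one_colored_perm[of n r] colored_perm_eq_iff)
qed

lemma group_G_rn:
  assumes "r > 0"
  shows "group (G_rn r n)"
proof (rule groupI)
  fix A B C assume "A \<in> carrier (G_rn r n)" "B \<in> carrier (G_rn r n)" "C \<in> carrier (G_rn r n)"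
  then have "A \<in> carrier_mat n n" "B \<in> carrier_mat n n" "C \<in> carrier_mat n n"
    by (auto simp: G_rn_def G_rn_carrier_def)
  then show "A \<otimes>\<^bsub>G_rn r n\<^esub> B \<otimes>\<^bsub>G_rn r n\<^esub> C = A \<otimes>\<^bsub>G_rn r n\<^esub> (B \<otimes>\<^bsub>G_rn r n\<^esub> C)"
    by (simp add: G_rn_def)
next
  fix A assume "A \<in> carrier (G_rn r n)"
  then obtain \<pi> x where \<pi>: "A = colored_perm r n \<pi> x" "\<pi> permutes {..<n}"
    by (auto simp: G_rn_def G_rn_carrier_eq[OF assms])
  then show "\<exists>B\<in>carrier (G_rn r n). B \<otimes>\<^bsub>G_rn r n\<^esub> A = \<one>\<^bsub>G_rn r n\<^esub>"
    using colored_perm_inverse[OF assms \<pi>(2), of x] permutes_inv[OF \<pi>(2)]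
    by (auto simp: G_rn_def G_rn_carrier_eq[OF assms])
  show "\<one>\<^bsub>G_rn r n\<^esub> \<otimes>\<^bsub>G_rn r n\<^esub> A = A"
    by (simp add: G_rn_def \<pi>(1)) (simp add: colored_perm_def)
next
  show "\<one>\<^bsub>G_rn r n\<^esub> \<in> carrier (G_rn r n)"
    using one_colored_perm[of n r] permutes_id[of "{..<n}"]
    by (auto simp: G_rn_def G_rn_carrier_eq[OF assms])
next
  fix A B assume "A \<in> carrier (G_rn r n)" "B \<in> carrier (G_rn r n)"
  then show "A \<otimes>\<^bsub>G_rn r n\<^esub> B \<in> carrier (G_rn r n)"
    by (auto simp: G_rn_def G_rn_carrier_eq[OF assms] colored_perm_mult) (metis permutes_compose)
qed

lemma G_rpn_carrier_eq:
  assumes "r > 0" "p dvd r"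
  shows "carrier (G_rpn r p n) =
    {colored_perm r n \<pi> x | \<pi> x. \<pi> permutes {..<n} \<and> p dvd (\<Sum>i<n. x i)}"
proof -
  have *: "(\<exists>k. s mod r = (p * k) mod r) \<longleftrightarrow> p dvd s" for s :: nat
  proof
    assume "\<exists>k. s mod r = (p * k) mod r"
    then show "p dvd s" using assms(2) by (metis dvd_mod_iff dvd_triv_left)
  qed auto
  have D: "Delta r n (colored_perm r n \<pi> x) \<in> {(p * k) mod r | k. True} \<longleftrightarrow> p dvd (\<Sum>i<n. x i)"
    if "\<pi> permutes {..<n}" for \<pi> x
    using *[of "\<Sum>i<n. x i"] by (simp add: Delta_colored_perm[OF assms(1) that])
  have C: "carrier (G_rpn r p n) = {g. (\<exists>\<pi> x. g = colored_perm r n \<pi> x \<and> \<pi> permutes {..<n}) \<and>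
      Delta r n g \<in> {(p * k) mod r | k. True}}"
    by (simp add: G_rpn_def G_rn_def G_rn_carrier_eq[OF assms(1)])
  show ?thesis
  proof (rule Set.set_eqI)
    fix g
    show "g \<in> carrier (G_rpn r p n) \<longleftrightarrow>
        g \<in> {colored_perm r n \<pi> x | \<pi> x. \<pi> permutes {..<n} \<and> p dvd (\<Sum>i<n. x i)}"
      unfolding C mem_Collect_eq using D[unfolded mem_Collect_eq] by metis
  qed
qed

lemma subgroup_G_rpn:
  assumes "r > 0" "p dvd r"
  shows "subgroup (carrier (G_rpn r p n)) (G_rn r n)"
proof -
  interpret group "G_rn r n" by (rule group_G_rn) fact
  show ?thesis
  proof (rule subgroupI)
    show "carrier (G_rpn r p n) \<subseteq> carrier (G_rn r n)" by (auto simp: G_rpn_def)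
    have "1\<^sub>m n \<in> carrier (G_rpn r p n)"
      unfolding G_rpn_carrier_eq[OF assms] one_colored_perm[of n r]
      by (rule CollectI, intro exI conjI, rule refl) (simp_all add: permutes_id)
    then show "carrier (G_rpn r p n) \<noteq> {}" by blast
  next
    fix A assume "A \<in> carrier (G_rpn r p n)"
    then obtain \<pi> x where A: "A = colored_perm r n \<pi> x" "\<pi> permutes {..<n}"
      "p dvd (\<Sum>i<n. x i)"
      by (auto simp: G_rpn_carrier_eq[OF assms])
    define B where "B = colored_perm r n (inv_into UNIV \<pi>) (\<lambda>i. (r - 1) * x (inv_into UNIV \<pi> i))"
    have inv: "inv_into UNIV \<pi> permutes {..<n}" using A(2) by (rule permutes_inv)
    have "(\<Sum>i<n. (r - 1) * x (inv_into UNIV \<pi> i)) = (r - 1) * (\<Sum>i<n. x i)"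
      using sum.permute[OF inv, of x] by (simp add: sum_distrib_left o_def)
    with A(3) inv have B: "B \<in> carrier (G_rpn r p n)"
      by (auto simp: B_def G_rpn_carrier_eq[OF assms] intro!: exI)
    moreover have "B \<otimes>\<^bsub>G_rn r n\<^esub> A = \<one>\<^bsub>G_rn r n\<^esub>"
      using colored_perm_inverse[OF assms(1) A(2)] by (simp add: G_rn_def A(1) B_def)
    moreover have "A \<in> carrier (G_rn r n)" "B \<in> carrier (G_rn r n)"
      using \<open>A \<in> carrier (G_rpn r p n)\<close> B by (auto simp: G_rpn_def)
    ultimately show "inv\<^bsub>G_rn r n\<^esub> A \<in> carrier (G_rpn r p n)"
      using inv_equality by metis
  next
    fix A B assume "A \<in> carrier (G_rpn r p n)" "B \<in> carrier (G_rpn r p n)"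
    then obtain \<pi> x \<sigma> y where A: "A = colored_perm r n \<pi> x" "\<pi> permutes {..<n}"
      "p dvd (\<Sum>i<n. x i)" and B: "B = colored_perm r n \<sigma> y" "\<sigma> permutes {..<n}"
      "p dvd (\<Sum>i<n. y i)"
      by (auto simp: G_rpn_carrier_eq[OF assms])
    have "(\<Sum>i<n. x (\<sigma> i) + y i) = (\<Sum>i<n. x i) + (\<Sum>i<n. y i)"
      using sum.permute[OF B(2), of x] by (simp add: sum.distrib o_def)
    with A B have "p dvd (\<Sum>i<n. x (\<sigma> i) + y i)" by simp
    moreover have "\<pi> \<circ> \<sigma> permutes {..<n}" using A B by (simp add: permutes_compose)
    ultimately show "A \<otimes>\<^bsub>G_rn r n\<^esub> B \<in> carrier (G_rpn r p n)"
      unfolding G_rpn_carrier_eq[OF assms]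
      by (auto simp: G_rn_def A(1) B(1) colored_perm_mult[OF B(2)])
  qed
qed

lemma G_rpn_eq: "G_rpn r p n = (G_rn r n)\<lparr>carrier := carrier (G_rpn r p n)\<rparr>"
  by (simp add: G_rpn_def)

lemma group_G_rpn: "r > 0 \<Longrightarrow> p dvd r \<Longrightarrow> group (G_rpn r p n)"
  using group.subgroup_imp_group[OF group_G_rn subgroup_G_rpn] G_rpn_eq by metis

lemma scalar_colored_perm: "zeta r ^ k \<cdot>\<^sub>m 1\<^sub>m n = colored_perm r n id (\<lambda>i. k)"
  by (auto intro!: eq_matI simp: colored_perm_def)

lemma scalar_pow_G_rn:
  "(zeta r ^ k \<cdot>\<^sub>m 1\<^sub>m n) [^]\<^bsub>G_rn r n\<^esub> (m :: nat) = zeta r ^ (k * m) \<cdot>\<^sub>m 1\<^sub>m n"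
proof (induction m)
  case 0
  show ?case by (auto intro!: eq_matI simp: nat_pow_def G_rn_def)
next
  case (Suc m)
  have "(zeta r ^ k \<cdot>\<^sub>m 1\<^sub>m n) [^]\<^bsub>G_rn r n\<^esub> Suc m =
      colored_perm r n id (\<lambda>i. k * m) * colored_perm r n id (\<lambda>i. k)"
    using Suc by (simp add: nat_pow_def G_rn_def scalar_colored_perm)
  also have "\<dots> = zeta r ^ (k * Suc m) \<cdot>\<^sub>m 1\<^sub>m n"
    by (simp add: colored_perm_mult permutes_id scalar_colored_perm add.commute del: power_Suc)
  finally show ?case .
qed

lemma C_q_eq:
  assumes "r > 0" "q dvd r"
  shows "C_q r q n = {zeta r ^ (r div q * k) \<cdot>\<^sub>m 1\<^sub>m n | k. k < q}"
proof -
  interpret group "G_rn r n" by (rule group_G_rn) fact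
  have q: "q > 0" using assms by (auto intro: Nat.gr0I)
  define c where "c = zeta r ^ (r div q) \<cdot>\<^sub>m 1\<^sub>m n"
  have c: "c \<in> carrier (G_rn r n)"
    unfolding c_def scalar_colored_perm G_rn_def using assms(1)
    by (auto simp: G_rn_carrier_eq permutes_id)
  have cq: "c [^]\<^bsub>G_rn r n\<^esub> q = \<one>\<^bsub>G_rn r n\<^esub>"
    using assms q by (simp add: c_def scalar_pow_G_rn zeta_power_order)
      (auto intro!: eq_matI simp: G_rn_def)
  have gen: "(zeta r \<cdot>\<^sub>m 1\<^sub>m n) [^]\<^bsub>G_rn r n\<^esub> (r div q) = c"
    using scalar_pow_G_rn[where r = r and k = 1 and n = n and m = "r div q"] by (simp add: c_def)
  have "c [^]\<^bsub>G_rn r n\<^esub> k \<in> {c [^]\<^bsub>G_rn r n\<^esub> l | l. l < q}" for k :: int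
  proof -
    have "c [^]\<^bsub>G_rn r n\<^esub> k = c [^]\<^bsub>G_rn r n\<^esub> (int q * (k div int q) + k mod int q)"
      by simp
    also have "\<dots> = (c [^]\<^bsub>G_rn r n\<^esub> int q) [^]\<^bsub>G_rn r n\<^esub> (k div int q) \<otimes>\<^bsub>G_rn r n\<^esub>
        c [^]\<^bsub>G_rn r n\<^esub> (k mod int q)"
      by (simp only: int_pow_mult[OF c] int_pow_pow[OF c])
    also have "\<dots> = c [^]\<^bsub>G_rn r n\<^esub> int (nat (k mod int q))"
      using c cq q by (simp add: int_pow_int int_pow_one)
    finally have "c [^]\<^bsub>G_rn r n\<^esub> k = c [^]\<^bsub>G_rn r n\<^esub> nat (k mod int q)"
      by (simp add: int_pow_int)
    moreover have "nat (k mod int q) < q" using q by (simp add: nat_less_iff)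
    ultimately show ?thesis by blast
  qed
  moreover have "c [^]\<^bsub>G_rn r n\<^esub> l \<in> {c [^]\<^bsub>G_rn r n\<^esub> k | k. k \<in> (UNIV :: int set)}" for l :: nat
    using int_pow_int[of "G_rn r n" c l] by (metis (mono_tags, lifting) UNIV_I mem_Collect_eq)
  ultimately have "{c [^]\<^bsub>G_rn r n\<^esub> k | k. k \<in> (UNIV :: int set)} =
      {c [^]\<^bsub>G_rn r n\<^esub> k | k. k < q}"
    by blast
  then have "C_q r q n = {c [^]\<^bsub>G_rn r n\<^esub> k | k. k < q}"
    by (simp add: C_q_def gen generate_pow[OF c])
  then show ?thesis by (simp add: c_def scalar_pow_G_rn)
qed

lemma card_C_q:
  assumes "r > 0" "n > 0" "q dvd r"
  shows "card (C_q r q n) = q"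
proof -
  have q: "q > 0" using assms by (auto intro: Nat.gr0I)
  have lt: "r div q * k < r" if "k < q" for k
    using that assms q by (auto elim!: dvdE)
  have "inj_on (\<lambda>k. zeta r ^ (r div q * k) \<cdot>\<^sub>m 1\<^sub>m n :: complex mat) {..<q}"
  proof (rule inj_onI)
    fix k l assume "k \<in> {..<q}" "l \<in> {..<q}"
      "zeta r ^ (r div q * k) \<cdot>\<^sub>m 1\<^sub>m n = (zeta r ^ (r div q * l) \<cdot>\<^sub>m 1\<^sub>m n :: complex mat)"
    then have "r div q * k = r div q * l"
      using assms(1,2) lt by (auto simp: scalar_colored_perm colored_perm_eq_iff permutes_id)
    then show "k = l" using assms q by (auto elim!: dvdE)
  qed
  moreover have "C_q r q n = (\<lambda>k. zeta r ^ (r div q * k) \<cdot>\<^sub>m 1\<^sub>m n) ` {..<q}"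
    by (auto simp: C_q_eq[OF assms(1,3)])
  ultimately show ?thesis by (simp add: card_image)
qed

lemma C_q_normal:
  assumes "r > 0" "p dvd r" "q dvd r" "p * q dvd r * n"
  shows "C_q r q n \<lhd> G_rpn r p n"
proof -
  interpret G: group "G_rn r n" by (rule group_G_rn) fact
  interpret H: group "G_rpn r p n" by (rule group_G_rpn) fact+
  have q: "q > 0" using assms by (auto intro: Nat.gr0I)
  have p: "p dvd n * (r div q)"
    using assms(3,4) q by (auto elim!: dvdE simp: algebra_simps)
  have C_carrier: "C_q r q n \<subseteq> carrier (G_rpn r p n)"
  proof -
    have "zeta r ^ (r div q * k) \<cdot>\<^sub>m 1\<^sub>m n \<in> carrier (G_rpn r p n)" for k
    proof -
      have "p dvd (\<Sum>i<n. r div q * k)" using p by (simp flip: mult.assoc)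
      then show ?thesis
        unfolding scalar_colored_perm G_rpn_carrier_eq[OF assms(1,2)]
        using permutes_id[of "{..<n}"] by blast
    qed
    then show ?thesis by (auto simp: C_q_eq[OF assms(1,3)])
  qed
  have "subgroup (C_q r q n) (G_rn r n)"
    unfolding C_q_def using scalar_pow_G_rn[where r = r and k = 1 and n = n and m = "r div q"]
    by (intro G.generate_is_subgroup)
      (auto simp: scalar_colored_perm G_rn_def G_rn_carrier_eq[OF assms(1)] permutes_id)
  then have sub: "subgroup (C_q r q n) (G_rpn r p n)"
    using G.subgroup_incl[OF _ subgroup_G_rpn[OF assms(1,2)] C_carrier] G_rpn_eq by metis
  have central: "A * B = B * A" if A: "A \<in> carrier (G_rpn r p n)" and B: "B \<in> C_q r q n" for A B
  proof -
    from A obtain \<pi> x where \<pi>: "A = colored_perm r n \<pi> x" "\<pi> permutes {..<n}"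
      by (auto simp: G_rpn_carrier_eq[OF assms(1,2)])
    from B obtain k where "B = colored_perm r n id (\<lambda>i. k)"
      by (auto simp: C_q_eq[OF assms(1,3)] scalar_colored_perm)
    with \<pi> show ?thesis by (simp add: colored_perm_mult permutes_id add.commute)
  qed
  show ?thesis
  proof (rule H.normalI[OF sub], intro ballI)
    fix A assume "A \<in> carrier (G_rpn r p n)"
    then have "\<And>B. B \<in> C_q r q n \<Longrightarrow> A \<otimes>\<^bsub>G_rpn r p n\<^esub> B = B \<otimes>\<^bsub>G_rpn r p n\<^esub> A"
      using central by (simp add: G_rpn_def G_rn_def)
    then show "C_q r q n #>\<^bsub>G_rpn r p n\<^esub> A = A <#\<^bsub>G_rpn r p n\<^esub> C_q r q n"
      by (auto simp: r_coset_def l_coset_def)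
  qed
qed

end

theory Submission
  imports Defs "HOL-Number_Theory.Cong"
begin

text \<open>
  \<open>G(r,p,q,n)\<close> is the semidirect product of \<open>S\<^sub>n\<close> with \<open>{x. p dvd \<Sum>x\<^sub>i} / \<langle>(r/q, \<dots>, r/q)\<rangle>\<close>, so an
  isomorphism of these \<open>S\<^sub>n\<close>-modules suffices. We take one of the form
  \<open>x \<mapsto> a x + b (\<Sum>x\<^sub>i / p) (1, \<dots>, 1)\<close>. It is well defined when \<open>p\<close> divides \<open>b q'\<close> and
  \<open>a p + b n = k p'\<close> for some \<open>k\<close>, and bijective if moreover \<open>a\<close> and \<open>k\<close> are units modulo \<open>r\<close>.
  Such \<open>a\<close>, \<open>b\<close>, \<open>k\<close> exist because, for every prime \<open>l\<close>, the two gcd conditions leave only two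
  possibilities: either \<open>p, p'\<close> have the same \<open>l\<close>-adic valuation, or all of \<open>p, p', q, q'\<close> have at
  least the valuation of \<open>n\<close>.
\<close>

section \<open>Existence of the multipliers \<open>a\<close>, \<open>b\<close>,
  \<open>k\<close>\<close>

text \<open>Let \<open>t\<close> be the product of the primes of \<open>r\<close> that do not divide
  \<open>a\<close>. Then each prime of \<open>r\<close> divides exactly one of \<open>a\<close> and
  \<open>N * t\<close>. Adding \<open>r * B\<close> makes \<open>t\<close> large and changes nothing
  modulo these primes.\<close>

lemma exists_coprime_shift:
  fixes a N r B :: nat
  assumes "coprime a N" "r > 0"
  shows "\<exists>t\<ge>B. coprime (a + N * t) r"
proof -
  define S where "S = {l \<in> prime_factors r. \<not> l dvd a}"
  define t where "t = \<Prod>S + r * B"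
  have fin: "finite S" by (simp add: S_def)
  have "coprime (a + N * t) r"
  proof (rule ccontr)
    assume "\<not> coprime (a + N * t) r"
    then obtain l where l: "prime l" "l dvd a + N * t" "l dvd r"
      by (metis coprime_iff_gcd_eq_1 gcd_nat.bounded_iff prime_factor_nat)
    have "a + N * t = (a + N * \<Prod>S) + r * (N * B)" by (simp add: t_def algebra_simps)
    with l have dvd: "l dvd a + N * \<Prod>S"
      by (metis dvd_add_left_iff dvd_mult2)
    show False
    proof (cases "l dvd a")
      case True
      then have "\<not> l dvd N" using assms(1) l(1)
        by (metis coprime_common_divisor not_prime_unit)
      with True dvd l(1) have "l dvd \<Prod>S"
        by (metis dvd_add_right_iff prime_dvd_mult_iff)
      then obtain s where "s \<in> S" "l dvd s"
        using prime_dvd_prod_iff[OF fin l(1), of "\<lambda>x. x"] by auto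
      then show False using True l(1)
        by (auto simp: S_def in_prime_factors_iff dest: primes_dvd_imp_eq)
    next
      case False
      then have "l \<in> S" using l assms(2) by (auto simp: S_def in_prime_factors_iff)
      then have "l dvd \<Prod>S" using fin by (metis dvd_prod_eqI)
      with dvd False show False by (metis dvd_add_left_iff dvd_mult)
    qed
  qed
  moreover have "t \<ge> B" using assms(2) by (simp add: t_def trans_le_add2)
  ultimately show ?thesis by blast
qed

lemma multiplicity_div_nat:
  fixes m d l :: nat
  assumes "prime l" "d dvd m" "m > 0"
  shows "multiplicity l (m div d) + multiplicity l d = multiplicity l m"
proof -
  from assms(2) obtain e where e: "m = d * e" ..
  with assms have "d \<noteq> 0" "e \<noteq> 0" by auto
  with e assms(1) show ?thesis by (simp add: prime_elem_multiplicity_mult_distrib)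
qed

lemma multipliers_exist:
  fixes r n p p' q q' :: nat
  assumes pos: "r > 0" "n > 0" "p > 0" "p' > 0" "q > 0" "q' > 0"
    and pq: "p * q = p' * q'"
    and gcds: "gcd p n = gcd p' n" "gcd q n = gcd q' n"
  shows "\<exists>a b k. coprime a r \<and> coprime k r \<and> p dvd b * q' \<and> a * p + b * n = k * p'"
proof -
  txt \<open>The choice \<open>a = p'/h\<close>, \<open>k = p/h\<close>, \<open>b = 0\<close> fails only because these need not be units modulo
    \<open>r\<close>. They may be changed modulo \<open>N\<close>, the smallest modulus that keeps \<open>W\<close> a divisor of
    \<open>k p' - a p = b n\<close>, which is what makes \<open>b\<close> integral with \<open>p dvd b q'\<close>.\<close>
  define h g where "h = gcd p p'" and "g = gcd p q'"
  \<comment> \<open>\<open>p dvd b * q'\<close> means that \<open>p div g\<close> divides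
    \<open>b\<close>, so the admissible values of \<open>b * n\<close> are the multiples of
    \<open>W\<close>.\<close>
  define W where "W = n * (p div g)"
  define N where "N = W div gcd W h"
  have hpos: "h > 0" and gpos: "g > 0" using pos by (simp_all add: h_def g_def)
  have "p div g > 0" using pos gpos by (simp add: g_def dvd_imp_le div_greater_zero_iff)
  then have Wpos: "W > 0" using pos by (simp add: W_def)
  \<comment> \<open>Write v for the valuation at \<open>l\<close>. If v(p) and v(p') differ, the gcd
    conditions and \<open>pq\<close> put v of all of \<open>p\<close>, \<open>p'\<close>,
    \<open>q\<close>, \<open>q'\<close> at or above v(n). Then v(W) is v(n) or v(n) + v(p) - v(q') =
    v(n) + v(p') - v(q), hence at most v(h), and \<open>l\<close> cannot divide
    \<open>N\<close>.\<close>
  have same: "multiplicity l p = multiplicity l p'" if l: "prime l" "l dvd N" for l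
  proof -
    have gcd_v: "multiplicity l (gcd x y) = min (multiplicity l x) (multiplicity l y)"
      if "x > 0" "y > 0" for x y
      using that l(1) by (simp add: multiplicity_gcd)
    have mult_v: "multiplicity l (x * y) = multiplicity l x + multiplicity l y"
      if "x > 0" "y > 0" for x y
      using that l(1) by (simp add: prime_elem_multiplicity_mult_distrib)
    have "N > 0" using Wpos by (simp add: N_def dvd_imp_le div_greater_zero_iff)
    then have vN: "multiplicity l N > 0" using l by (simp add: prime_multiplicity_gt_zero_iff)
    have "multiplicity l N + multiplicity l (gcd W h) = multiplicity l W"
      unfolding N_def using multiplicity_div_nat[OF l(1) _ Wpos] by simp
    moreover have "multiplicity l (gcd W h) = min (multiplicity l W) (multiplicity l h)"
      using gcd_v Wpos hpos by blast
    moreover have "multiplicity l h = min (multiplicity l p) (multiplicity l p')"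
      unfolding h_def using gcd_v pos by blast
    moreover have "multiplicity l W = multiplicity l n + multiplicity l (p div g)"
      unfolding W_def using mult_v pos \<open>p div g > 0\<close> by blast
    moreover have "multiplicity l (p div g) + min (multiplicity l p) (multiplicity l q') = multiplicity l p"
      using multiplicity_div_nat[OF l(1) _ pos(3), of g] gcd_v[of p q'] pos by (simp add: g_def)
    moreover have "min (multiplicity l p) (multiplicity l n) = min (multiplicity l p') (multiplicity l n)"
      using gcd_v[of p n] gcd_v[of p' n] pos gcds(1) by simp
    moreover have "min (multiplicity l q) (multiplicity l n) = min (multiplicity l q') (multiplicity l n)"
      using gcd_v[of q n] gcd_v[of q' n] pos gcds(2) by simp
    moreover have "multiplicity l p + multiplicity l q = multiplicity l p' + multiplicity l q'"
      using mult_v[of p q] mult_v[of p' q'] pos pq by simp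
    ultimately show ?thesis using vN by linarith
  qed
  have cop: "coprime (p div h) N" "coprime (p' div h) N"
  proof -
    have *: "coprime (m div h) N" if m: "m \<in> {p, p'}" for m
    proof (rule ccontr)
      assume "\<not> coprime (m div h) N"
      then obtain l where l: "prime l" "l dvd m div h" "l dvd N"
        by (metis coprime_iff_gcd_eq_1 gcd_nat.bounded_iff prime_factor_nat)
      have m': "m > 0" "h dvd m" using m pos by (auto simp: h_def)
      then have "m div h > 0" using hpos by (simp add: dvd_imp_le div_greater_zero_iff)
      then have "multiplicity l (m div h) > 0" using l by (simp add: prime_multiplicity_gt_zero_iff)
      moreover have "multiplicity l (m div h) + multiplicity l h = multiplicity l m"
        using multiplicity_div_nat l(1) m' by blast
      moreover have "multiplicity l h = min (multiplicity l p) (multiplicity l p')"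
        using pos l(1) by (simp add: h_def multiplicity_gcd)
      ultimately show False using same[OF l(1,3)] m by auto
    qed
    show "coprime (p div h) N" "coprime (p' div h) N" using *[of p] *[of p'] by auto
  qed
  obtain s where s: "coprime (p' div h + N * s) r"
    using exists_coprime_shift[OF cop(2) pos(1)] by blast
  \<comment> \<open>The bound on \<open>t\<close> gives \<open>s * p \<le> t * p'\<close>, so that
    \<open>d\<close>, and with it \<open>b\<close>, is a natural number.\<close>
  obtain t where t: "t \<ge> s * p" "coprime (p div h + N * t) r"
    using exists_coprime_shift[OF cop(1) pos(1)] by blast
  define a k where "a = p' div h + N * s" and "k = p div h + N * t"
  have "s * p \<le> t * p'" using t(1) pos(4) by (metis dual_order.trans mult_le_mono2 nat_mult_1_right Suc_leI One_nat_def)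
  then obtain d where d: "t * p' = s * p + d" using le_Suc_ex by blast
  have cross: "(p div h) * p' = (p' div h) * p"
    by (simp add: h_def div_mult_swap mult.commute)
  have "k * p' = (p div h) * p' + N * (t * p')" by (simp add: k_def algebra_simps)
  also have "\<dots> = a * p + N * d" unfolding cross d by (simp add: a_def algebra_simps)
  finally have eq: "k * p' = a * p + N * d" .
  \<comment> \<open>The factor \<open>gcd W h\<close> could be dropped from \<open>N\<close> because
    \<open>d\<close> supplies it.\<close>
  have "h dvd t * p'" "h dvd s * p" by (simp_all add: h_def)
  then have "h dvd d" by (simp add: d dvd_add_right_iff)
  then have "N * gcd W h dvd N * d" by (meson dvd_refl dvd_trans gcd_dvd2 mult_dvd_mono)
  then have "W dvd N * d" by (simp add: N_def)
  then obtain e where e: "N * d = W * e" ..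
  define b where "b = (p div g) * e"
  have "b * n = N * d" using e by (simp add: b_def W_def algebra_simps)
  moreover have "b * q' = p * (e * (q' div g))"
    by (simp add: b_def g_def dvd_div_mult div_mult_swap ac_simps)
  moreover have "coprime a r" "coprime k r" using s t by (simp_all add: a_def k_def)
  ultimately show ?thesis using eq by (metis dvd_triv_left)
qed

section \<open>The central subgroup and equality of its cosets\<close>

text \<open>The scalars in \<open>C_q r q n\<close> are the \<open>q\<close>-th roots of unity. This
  form needs neither the quotient \<open>r div q\<close> nor a bound on the exponent.\<close>

lemma C_q_iff:
  assumes "r > 0" "q dvd r"
  shows "A \<in> C_q r q n \<longleftrightarrow> (\<exists>d. A = colored_perm r n id (\<lambda>i. d) \<and> r dvd q * d)"
proof
  assume "A \<in> C_q r q n"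
  then obtain k where "A = colored_perm r n id (\<lambda>i. r div q * k)"
    by (auto simp: C_q_eq[OF assms] scalar_colored_perm)
  moreover have "q * (r div q * k) = r * k" using assms(2) by (simp flip: mult.assoc)
  ultimately show "\<exists>d. A = colored_perm r n id (\<lambda>i. d) \<and> r dvd q * d" by (metis dvd_triv_left)
next
  assume "\<exists>d. A = colored_perm r n id (\<lambda>i. d) \<and> r dvd q * d"
  then obtain d where d: "A = colored_perm r n id (\<lambda>i. d)" "r dvd q * d" by blast
  from assms obtain m where m: "r = q * m" by blast
  with assms have q: "q > 0" "r div q = m" by auto
  from d(2) m q obtain k where k: "d = m * k" by auto
  have "m * (k mod q) = d mod r"
    unfolding k m by (simp only: mult_mod_right mult.commute[of q m])
  then have "m * (k mod q) mod r = d mod r" by simp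
  then have "A = colored_perm r n id (\<lambda>i. m * (k mod q))"
    using d(1) assms(1) by (simp add: colored_perm_eq_iff permutes_id)
  moreover have "k mod q < q" using q by simp
  ultimately show "A \<in> C_q r q n"
    unfolding C_q_eq[OF assms] scalar_colored_perm q(2) by blast
qed

lemma G_rpn_mult: "A \<otimes>\<^bsub>G_rpn r p n\<^esub> B = A * B"
  by (simp add: G_rpn_def G_rn_def)

text \<open>The two matrices differ by the scalar with exponent v - u, which lies in
  \<open>C_q r q n\<close> by \<open>uv\<close>. Two offsets are used in place of a difference of
  natural numbers.\<close>

lemma C_q_coset_eqI:
  assumes r: "r > 0" "p dvd r" "q dvd r" "p * q dvd r * n"
    and \<pi>: "\<pi> permutes {..<n}" and z: "p dvd (\<Sum>i<n. z i)"
    and uv: "[q * u = q * v] (mod r)"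
    and yz: "\<And>i. i < n \<Longrightarrow> [y i + u = z i + v] (mod r)"
  shows "C_q r q n #>\<^bsub>G_rpn r p n\<^esub> colored_perm r n \<pi> y =
    C_q r q n #>\<^bsub>G_rpn r p n\<^esub> colored_perm r n \<pi> z"
proof -
  interpret group "G_rpn r p n" by (rule group_G_rpn) fact+
  interpret normal "C_q r q n" "G_rpn r p n" by (rule C_q_normal) fact+
  \<comment> \<open>\<open>(r - 1) * u\<close> represents -u modulo \<open>r\<close>.\<close>
  define d where "d = v + (r - 1) * u"
  have ru: "u + (r - 1) * u = r * u" using r(1) by (cases r) auto
  have "[q * v + q * ((r - 1) * u) = q * u + q * ((r - 1) * u)] (mod r)"
    using uv by (simp add: cong_add cong_sym)
  also have "q * u + q * ((r - 1) * u) = r * (q * u)"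
    by (metis distrib_left ru mult.left_commute)
  finally have "[q * d = 0] (mod r)"
    by (simp add: d_def distrib_left cong_def)
  then have C: "colored_perm r n id (\<lambda>i. d) \<in> C_q r q n"
    unfolding C_q_iff[OF r(1,3)] by (auto simp: cong_0_iff)
  have "[d + z i = y i] (mod r)" if "i < n" for i
  proof -
    have "[z i + v + (r - 1) * u = y i + u + (r - 1) * u] (mod r)"
      using yz[OF that] by (simp add: cong_add cong_sym)
    also have "y i + u + (r - 1) * u = y i + r * u" using ru by simp
    finally show ?thesis by (simp add: d_def cong_def ac_simps)
  qed
  then have "colored_perm r n id (\<lambda>i. d) * colored_perm r n \<pi> z = colored_perm r n \<pi> y"
    using r(1) \<pi> by (simp add: colored_perm_mult colored_perm_eq_iff cong_def)
  with C have "colored_perm r n \<pi> y \<in> C_q r q n #>\<^bsub>G_rpn r p n\<^esub> colored_perm r n \<pi> z"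
    unfolding r_coset_def G_rpn_mult by (auto intro!: bexI)
  moreover have "colored_perm r n \<pi> z \<in> carrier (G_rpn r p n)"
    using \<pi> z by (auto simp: G_rpn_carrier_eq[OF r(1,2)])
  ultimately show ?thesis
    using repr_independence[OF _ _ is_subgroup] by metis
qed

section \<open>The homomorphism given by the multipliers\<close>

locale multipliers =
  fixes r n p p' q q' a b k :: nat
  assumes r: "r > 0" and n: "n > 0"
    and p: "p dvd r" and p': "p' dvd r" and q: "q dvd r" and q': "q' dvd r"
    and pq: "p * q = p' * q'" and pq_dvd: "p * q dvd r * n"
    and coprime_a: "coprime a r" and coprime_k: "coprime k r"
    and p_dvd: "p dvd b * q'" and eq: "a * p + b * n = k * p'"
begin

lemma pos: "p > 0" "p' > 0" "q > 0" "q' > 0"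
  using r p p' q q' by (auto intro: Nat.gr0I)

abbreviation G where "G \<equiv> G_rpn r p n"
abbreviation G' where "G' \<equiv> G_rpn r p' n"
abbreviation C where "C \<equiv> C_q r q n"
abbreviation C' where "C' \<equiv> C_q r q' n"

lemma pq_dvd': "p' * q' dvd r * n" using pq pq_dvd by simp

sublocale G: group G by (rule group_G_rpn[OF r p])
sublocale G': group G' by (rule group_G_rpn[OF r p'])
sublocale C: normal C G by (rule C_q_normal[OF r p q pq_dvd])
sublocale C': normal C' G' by (rule C_q_normal[OF r p' q' pq_dvd'])

text \<open>On vectors whose sum is divisible by \<open>p\<close> the division is exact, which makes
  the map additive there.\<close>

definition twist :: "(nat \<Rightarrow> nat) \<Rightarrow> nat \<Rightarrow> nat" where
  "twist x i = a * x i + b * ((\<Sum>j<n. x j) div p)"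

text \<open>If \<open>x\<close> has sum p s, its twist has sum (a p + b n) s, and \<open>eq\<close>
  turns this into a multiple of \<open>p'\<close>.\<close>

lemma sum_twist:
  assumes "p dvd (\<Sum>i<n. x i)"
  shows "(\<Sum>i<n. twist x i) = p' * (k * ((\<Sum>i<n. x i) div p))"
proof -
  from assms obtain s where s: "(\<Sum>i<n. x i) = p * s" by blast
  have "(\<Sum>i<n. twist x i) = (a * p + b * n) * s"
    using pos s by (simp add: twist_def sum.distrib algebra_simps flip: sum_distrib_left)
  also have "\<dots> = p' * (k * s)" by (simp add: eq)
  finally show ?thesis using s pos by simp
qed

text \<open>A matrix determines \<open>x\<close> only modulo \<open>r\<close>, and
  \<open>twist x\<close> may depend on the representatives; only the coset is independent of
  them.\<close>

definition twist_coset :: "complex mat \<Rightarrow> complex mat set" where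
  "twist_coset A = (THE Y. \<exists>\<pi> x. \<pi> permutes {..<n} \<and> p dvd (\<Sum>i<n. x i) \<and>
     A = colored_perm r n \<pi> x \<and> Y = C' #>\<^bsub>G'\<^esub> colored_perm r n \<pi> (twist x))"

text \<open>Another choice of representatives changes the sum by a multiple of \<open>r\<close>. By
  \<open>p_dvd\<close>, the change in the constant term of \<open>twist\<close>, multiplied by
  \<open>q'\<close>, is then a multiple of \<open>r\<close>, so it stays inside
  \<open>C'\<close>.\<close>

lemma twist_coset_colored_perm:
  assumes "\<pi> permutes {..<n}" "p dvd (\<Sum>i<n. x i)"
  shows "twist_coset (colored_perm r n \<pi> x) = C' #>\<^bsub>G'\<^esub> colored_perm r n \<pi> (twist x)"
  unfolding twist_coset_def
proof (rule the_equality)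
  fix Y
  assume "\<exists>\<sigma> y. \<sigma> permutes {..<n} \<and> p dvd (\<Sum>i<n. y i) \<and>
    colored_perm r n \<pi> x = colored_perm r n \<sigma> y \<and> Y = C' #>\<^bsub>G'\<^esub> colored_perm r n \<sigma> (twist y)"
  then obtain \<sigma> y where \<sigma>: "\<sigma> permutes {..<n}" and py: "p dvd (\<Sum>i<n. y i)"
    and xy: "colored_perm r n \<pi> x = colored_perm r n \<sigma> y"
    and Y: "Y = C' #>\<^bsub>G'\<^esub> colored_perm r n \<sigma> (twist y)" by blast
  from xy have "\<pi> = \<sigma>" and cong: "[x i = y i] (mod r)" if "i < n" for i
    using that colored_perm_eq_iff[OF r assms(1) \<sigma>] by (auto simp: cong_def)
  then have "\<pi> = \<sigma>" using n by blast
  from p_dvd obtain e where e: "b * q' = p * e" by blast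
  have e': "q' * (b * ((\<Sum>i<n. z i) div p)) = e * (\<Sum>i<n. z i)" if "p dvd (\<Sum>i<n. z i)" for z
  proof -
    have "q' * (b * ((\<Sum>i<n. z i) div p)) = (b * q') * ((\<Sum>i<n. z i) div p)" by (simp only: ac_simps)
    also have "\<dots> = e * (p * ((\<Sum>i<n. z i) div p))" by (simp only: e ac_simps)
    finally show ?thesis using that by simp
  qed
  have "[(\<Sum>i<n. y i) = (\<Sum>i<n. x i)] (mod r)"
    using cong by (intro cong_sum) (auto simp: cong_sym)
  then have "[q' * (b * ((\<Sum>i<n. x i) div p)) = q' * (b * ((\<Sum>i<n. y i) div p))] (mod r)"
    using e' assms(2) py by (simp add: cong_mult cong_sym)
  moreover have "[twist y i + b * ((\<Sum>i<n. x i) div p) = twist x i + b * ((\<Sum>i<n. y i) div p)] (mod r)"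
    if "i < n" for i
  proof -
    have "[a * y i + (b * ((\<Sum>i<n. y i) div p) + b * ((\<Sum>i<n. x i) div p)) =
        a * x i + (b * ((\<Sum>i<n. y i) div p) + b * ((\<Sum>i<n. x i) div p))] (mod r)"
      by (intro cong_add cong_mult cong_refl cong_sym[OF cong[OF that]])
    then show ?thesis by (simp only: twist_def ac_simps)
  qed
  moreover have "p' dvd (\<Sum>i<n. twist x i)" using sum_twist[OF assms(2)] by simp
  ultimately have "C' #>\<^bsub>G'\<^esub> colored_perm r n \<pi> (twist y) =
      C' #>\<^bsub>G'\<^esub> colored_perm r n \<pi> (twist x)"
    using C_q_coset_eqI[OF r p' q' pq_dvd' assms(1)] by blast
  with Y \<open>\<pi> = \<sigma>\<close> show "Y = C' #>\<^bsub>G'\<^esub> colored_perm r n \<pi> (twist x)" by simp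
qed (use assms in blast)

lemma twist_closed:
  assumes "\<pi> permutes {..<n}" "p dvd (\<Sum>i<n. x i)"
  shows "colored_perm r n \<pi> (twist x) \<in> carrier G'"
proof -
  have "p' dvd (\<Sum>i<n. twist x i)" using sum_twist[OF assms(2)] by simp
  with assms(1) show ?thesis unfolding G_rpn_carrier_eq[OF r p'] by blast
qed

text \<open>The sum is invariant under permutations, so \<open>twist\<close> commutes with permuting
  coordinates; it is also additive on the vectors in question.\<close>

lemma twist_coset_hom: "twist_coset \<in> hom G (G' Mod C')"
proof (rule homI)
  fix A assume "A \<in> carrier G"
  then obtain \<pi> x where "A = colored_perm r n \<pi> x" "\<pi> permutes {..<n}" "p dvd (\<Sum>i<n. x i)"
    by (auto simp: G_rpn_carrier_eq[OF r p])
  then show "twist_coset A \<in> carrier (G' Mod C')"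
    by (simp add: twist_coset_colored_perm twist_closed carrier_FactGroup)
next
  fix A B assume "A \<in> carrier G" "B \<in> carrier G"
  then obtain \<pi> x \<sigma> y where A: "A = colored_perm r n \<pi> x" "\<pi> permutes {..<n}" "p dvd (\<Sum>i<n. x i)"
    and B: "B = colored_perm r n \<sigma> y" "\<sigma> permutes {..<n}" "p dvd (\<Sum>i<n. y i)"
    by (auto simp: G_rpn_carrier_eq[OF r p])
  have sum: "(\<Sum>i<n. x (\<sigma> i) + y i) = (\<Sum>i<n. x i) + (\<Sum>i<n. y i)"
    using sum.permute[OF B(2), of x] by (simp add: sum.distrib o_def)
  then have div: "(\<Sum>i<n. x (\<sigma> i) + y i) div p = (\<Sum>i<n. x i) div p + (\<Sum>i<n. y i) div p"
    using A(3) by (simp add: div_plus_div_distrib_dvd_left)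
  have twist: "twist (\<lambda>i. x (\<sigma> i) + y i) = (\<lambda>i. twist x (\<sigma> i) + twist y i)"
    unfolding twist_def div by (simp add: algebra_simps)
  have "twist_coset (A * B) = C' #>\<^bsub>G'\<^esub> colored_perm r n (\<pi> \<circ> \<sigma>) (twist (\<lambda>i. x (\<sigma> i) + y i))"
    using A B sum
    by (simp add: colored_perm_mult twist_coset_colored_perm permutes_compose)
  also have "\<dots> = C' #>\<^bsub>G'\<^esub> (colored_perm r n \<pi> (twist x) \<otimes>\<^bsub>G'\<^esub> colored_perm r n \<sigma> (twist y))"
    using B(2) by (simp add: twist G_rpn_mult colored_perm_mult)
  also have "\<dots> = twist_coset A \<otimes>\<^bsub>G' Mod C'\<^esub> twist_coset B"
    using A B by (simp add: C'.rcos_sum twist_coset_colored_perm twist_closed mult_FactGroup)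
  finally show "twist_coset (A \<otimes>\<^bsub>G\<^esub> B) = twist_coset A \<otimes>\<^bsub>G' Mod C'\<^esub> twist_coset B"
    by (simp add: G_rpn_mult)
qed

sublocale twist: group_hom G "G' Mod C'" twist_coset
  by (intro group_hom.intro group_hom_axioms.intro C'.factorgroup_is_group twist_coset_hom)
    (rule G.is_group)

section \<open>Kernel of the homomorphism\<close>

text \<open>For the constant vector \<open>c\<close>, whose sum is \<open>n * c\<close>, this
  compares membership of the image in \<open>C'\<close> with membership in \<open>C\<close>.
  Multiplying by \<open>p\<close> and using \<open>eq\<close> and \<open>pq\<close> leaves the
  factor \<open>k\<close>, a unit modulo \<open>r\<close>.\<close>

lemma dvd_twist_const_iff:
  assumes "p dvd n * c"
  shows "r dvd q' * (a * c + b * (n * c div p)) \<longleftrightarrow> r dvd q * c"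
proof -
  have "p * (q' * (a * c + b * (n * c div p))) = q' * (a * p * c + b * (p * (n * c div p)))"
    by (simp add: algebra_simps)
  also have "\<dots> = q' * c * (a * p + b * n)" using assms by (simp add: algebra_simps)
  also have "\<dots> = p * (k * (q * c))" using pq by (simp add: eq ac_simps)
  finally have "q' * (a * c + b * (n * c div p)) = k * (q * c)" using pos by simp
  then show ?thesis using coprime_k by (simp add: coprime_dvd_mult_right_iff coprime_commute)
qed

text \<open>If the image lies in \<open>C'\<close>, then \<open>\<pi>\<close> is the identity and
  \<open>twist x\<close> is constant modulo \<open>r\<close>. Its second summand does not depend on
  the coordinate and \<open>a\<close> is a unit, so \<open>x\<close> is constant too, and the
  criterion for constant vectors applies.\<close>

lemma kernel_twist_coset: "kernel G (G' Mod C') twist_coset = C"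
proof -
  have iff: "twist_coset A = C' \<longleftrightarrow> colored_perm r n \<pi> (twist x) \<in> C'"
    if "A = colored_perm r n \<pi> x" "\<pi> permutes {..<n}" "p dvd (\<Sum>i<n. x i)" for A \<pi> x
    using that twist_closed[OF that(2,3)] G'.coset_join1[OF _ _ C'.is_subgroup]
      G'.coset_join2[OF _ C'.is_subgroup]
    by (auto simp: twist_coset_colored_perm)
  have const: "twist_coset (colored_perm r n id (\<lambda>i. c)) = C' \<longleftrightarrow> r dvd q * c" if "p dvd n * c" for c
  proof -
    have "twist_coset (colored_perm r n id (\<lambda>i. c)) = C' \<longleftrightarrow>
        colored_perm r n id (\<lambda>i. a * c + b * (n * c div p)) \<in> C'"
      using iff[OF refl permutes_id, of "\<lambda>i. c"] that by (simp add: twist_def[abs_def])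
    also have "\<dots> \<longleftrightarrow> r dvd q' * (a * c + b * (n * c div p))" (is "_ \<longleftrightarrow> r dvd q' * ?d")
    proof
      assume "colored_perm r n id (\<lambda>i. ?d) \<in> C'"
      then obtain d where "[?d = d] (mod r)" "r dvd q' * d"
        using n r by (auto simp: C_q_iff[OF r q'] colored_perm_eq_iff permutes_id cong_def)
      then show "r dvd q' * ?d"
        by (metis cong_dvd_iff cong_mult cong_refl)
    qed (auto simp: C_q_iff[OF r q'])
    also have "\<dots> \<longleftrightarrow> r dvd q * c" by (rule dvd_twist_const_iff) fact
    finally show ?thesis .
  qed
  show ?thesis
  proof (intro equalityI subsetI)
    fix A assume "A \<in> kernel G (G' Mod C') twist_coset"
    then have "A \<in> carrier G" and ker: "twist_coset A = C'" by (auto simp: kernel_def)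
    then obtain \<pi> x where A: "A = colored_perm r n \<pi> x" "\<pi> permutes {..<n}" "p dvd (\<Sum>i<n. x i)"
      by (auto simp: G_rpn_carrier_eq[OF r p])
    with ker iff have "colored_perm r n \<pi> (twist x) \<in> C'" by blast
    then obtain d where "\<pi> = id" and d: "\<And>i. i < n \<Longrightarrow> [twist x i = d] (mod r)"
      using A(2) by (auto simp: C_q_iff[OF r q'] colored_perm_eq_iff[OF r] permutes_id cong_def)
    define c where "c = x 0"
    have xc: "[x i = c] (mod r)" if "i < n" for i
    proof -
      have "[twist x i = twist x 0] (mod r)" using d that n by (meson cong_sym cong_trans)
      then have "[a * x i = a * x 0] (mod r)" by (simp add: twist_def cong_add_rcancel_nat)
      then show ?thesis using coprime_a by (simp add: c_def cong_mult_lcancel_nat coprime_commute)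
    qed
    then have Ac: "A = colored_perm r n id (\<lambda>i. c)"
      using A xc \<open>\<pi> = id\<close> r by (simp add: colored_perm_eq_iff permutes_id cong_def)
    have "[(\<Sum>i<n. x i) = (\<Sum>i<n. c)] (mod r)"
      by (rule cong_sum) (use xc in simp)
    then have "[(\<Sum>i<n. x i) = n * c] (mod p)"
      using cong_dvd_modulus_nat[OF _ p] by simp
    then have "p dvd n * c" using A(3) cong_dvd_iff by blast
    with const ker Ac have "r dvd q * c" by blast
    with Ac show "A \<in> C" by (auto simp: C_q_iff[OF r q])
  next
    fix A assume "A \<in> C"
    then obtain c where A: "A = colored_perm r n id (\<lambda>i. c)" "r dvd q * c"
      by (auto simp: C_q_iff[OF r q])
    have "r * n dvd (q * c) * n" using A(2) by (rule mult_dvd_mono) simp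
    with pq_dvd have "p * q dvd (q * c) * n" by (rule dvd_trans)
    then have "q * p dvd q * (n * c)" by (simp only: ac_simps)
    then have "p dvd n * c" using pos by simp
    with const A have "twist_coset A = C'" by blast
    with \<open>A \<in> C\<close> show "A \<in> kernel G (G' Mod C') twist_coset"
      using C.subset by (auto simp: kernel_def)
  qed
qed

section \<open>Surjectivity and the isomorphism\<close>

lemma twist_coset_surj: "twist_coset ` carrier G = carrier (G' Mod C')"
proof
  show "twist_coset ` carrier G \<subseteq> carrier (G' Mod C')" using twist.hom_closed by blast
  show "carrier (G' Mod C') \<subseteq> twist_coset ` carrier G"
  proof
    fix Y assume "Y \<in> carrier (G' Mod C')"
    then obtain \<pi> y where Y: "Y = C' #>\<^bsub>G'\<^esub> colored_perm r n \<pi> y"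
      and \<pi>: "\<pi> permutes {..<n}" and py: "p' dvd (\<Sum>i<n. y i)"
      by (auto simp: carrier_FactGroup G_rpn_carrier_eq[OF r p'])
    from py obtain t where t: "(\<Sum>i<n. y i) = p' * t" by blast
    obtain \<alpha> where \<alpha>: "[a * \<alpha> = 1] (mod r)"
      using cong_solve_coprime_nat[OF coprime_a] by auto
    obtain \<kappa>' where \<kappa>': "[k * \<kappa>' = 1] (mod r)"
      using cong_solve_coprime_nat[OF coprime_k] by auto
    \<comment> \<open>\<open>\<kappa>\<close> is the negative of the inverse of \<open>k\<close>
      modulo \<open>r\<close>.\<close>
    define \<kappa> where "\<kappa> = (r - 1) * \<kappa>'"
    have "[1 + k * \<kappa> = k * \<kappa>' + k * \<kappa>] (mod r)" by (rule cong_add[OF cong_sym[OF \<kappa>'] cong_refl])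
    also have "k * \<kappa>' + k * \<kappa> = r * (k * \<kappa>')" using r by (cases r) (auto simp: \<kappa>_def algebra_simps)
    finally obtain m where m: "1 + k * \<kappa> = r * m" by (metis cong_0_iff cong_dvd_iff dvd_triv_left dvdE)
    \<comment> \<open>Solving a x + b s = y, where s = t / k because sums are scaled by
      \<open>k\<close>, gives x = (y - b t / k) / a, that is
      \<open>\<alpha> * y i + \<beta> * t\<close>.\<close>
    define \<beta> where "\<beta> = \<alpha> * b * \<kappa>"
    have "\<alpha> * p' + \<beta> * n + \<alpha> * a * p * \<kappa> = \<alpha> * p' + \<alpha> * \<kappa> * (a * p + b * n)"
      by (simp add: \<beta>_def algebra_simps)
    also have "\<dots> = \<alpha> * p' * (1 + k * \<kappa>)" by (simp add: eq algebra_simps)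
    also have "\<dots> = \<alpha> * p' * r * m" by (simp only: m mult.assoc)
    finally have sum_eq: "\<alpha> * p' + \<beta> * n + \<alpha> * a * p * \<kappa> = \<alpha> * p' * r * m" .
    then have "p dvd \<alpha> * p' + \<beta> * n"
      using p by (metis dvd_add_left_iff dvd_mult dvd_mult2 dvd_triv_right)
    then obtain w where w: "\<alpha> * p' + \<beta> * n = p * w" by blast
    define x where "x i = \<alpha> * y i + \<beta> * t" for i
    have sum_x: "(\<Sum>i<n. x i) = p * (w * t)"
    proof -
      have "(\<Sum>i<n. x i) = (\<alpha> * p' + \<beta> * n) * t"
        using t by (simp add: x_def sum.distrib algebra_simps flip: sum_distrib_left)
      then show ?thesis by (simp add: w)
    qed
    have twist_x: "twist x i = a * \<alpha> * y i + (a * \<beta> + b * w) * t" for i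
      using pos sum_x by (simp add: twist_def x_def algebra_simps)
    \<comment> \<open>Modulo \<open>r\<close>, \<open>twist x\<close> differs from \<open>y\<close>
      by this constant times \<open>t\<close>. The constant need not vanish, but it gives a scalar
      in \<open>C'\<close>: \<open>p\<close> times it is \<open>b\<close> times a multiple of
      \<open>r\<close>, and after multiplication by \<open>q'\<close> the factor \<open>p\<close>
      cancels against \<open>b * q'\<close>.\<close>
    have "r dvd q' * (a * \<beta> + b * w)"
    proof -
      have "p * (a * \<beta> + b * w) = b * (p * w + \<alpha> * a * p * \<kappa>)" by (simp add: \<beta>_def algebra_simps)
      also have "\<dots> = b * (\<alpha> * p' * r * m)" by (simp only: sum_eq flip: w)
      finally have "p * (q' * (a * \<beta> + b * w)) = b * q' * (\<alpha> * p' * r * m)" by (simp add: ac_simps)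
      moreover from p_dvd obtain e where "b * q' = p * e" by blast
      ultimately have "q' * (a * \<beta> + b * w) = e * (\<alpha> * p' * r * m)" using pos by simp
      then show ?thesis by simp
    qed
    then have "[q' * ((a * \<beta> + b * w) * t) = q' * 0] (mod r)"
      by (simp add: cong_0_iff flip: mult.assoc)
    then have "[q' * 0 = q' * ((a * \<beta> + b * w) * t)] (mod r)" by (rule cong_sym)
    moreover have "[twist x i + 0 = y i + (a * \<beta> + b * w) * t] (mod r)" for i
      using cong_add[OF cong_scalar_right[OF \<alpha>, of "y i"] cong_refl]
      by (simp only: twist_x mult_1 add_0_right)
    ultimately have "C' #>\<^bsub>G'\<^esub> colored_perm r n \<pi> (twist x) = Y"
      unfolding Y using C_q_coset_eqI[OF r p' q' pq_dvd' \<pi> py] by blast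
    moreover have px: "p dvd (\<Sum>i<n. x i)" by (simp add: sum_x)
    ultimately have "Y = twist_coset (colored_perm r n \<pi> x)"
      using \<pi> by (simp add: twist_coset_colored_perm)
    moreover have "colored_perm r n \<pi> x \<in> carrier G"
      unfolding G_rpn_carrier_eq[OF r p] using \<pi> px by blast
    ultimately show "Y \<in> twist_coset ` carrier G" by blast
  qed
qed

lemma G_rpqn_iso: "G_rpqn r p q n \<cong> G_rpqn r p' q' n"
  using twist.FactGroup_iso[OF twist_coset_surj] by (simp add: G_rpqn_def kernel_twist_coset)

end

theorem theorem3p3:
  fixes r n p p' q q' :: nat
  assumes "r > 0" and "n > 0"
    and "p > 0" and "p' > 0" and "q > 0" and "q' > 0"
    and "p dvd r" and "p' dvd r" and "q dvd r" and "q' dvd r"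
    and "p * q = p' * q'" and "p * q dvd r * n"
    and "gcd p n = gcd p' n" and "gcd q n = gcd q' n"
  shows "G_rpqn r p q n \<cong> G_rpqn r p' q' n"
proof -
  obtain a b k where "coprime a r" "coprime k r" "p dvd b * q'" "a * p + b * n = k * p'"
    using multipliers_exist[of r n p p' q q'] assms by blast
  with assms interpret multipliers r n p p' q q' a b k
    by unfold_locales
  show ?thesis by (rule G_rpqn_iso)
qed

end
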